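(* Let $\Gamma$ be a finite, non-empty simplicial graph. There exist infinitely many $\Gamma$-partite graphs which contain no simple $4$-cycles and no simple $3$-cycles. Additionally, these $\Gamma$-partite graphs can be constructed to have cycle connectors, and they can also be constructed to have path connectors (that is, there are infinitely many such graphs with cycle connectors and infinitely many such graphs with path connectors).
   Context: Let $\Gamma$ be a simplicial graph with vertex set $\{s_1,\dots,s_n\}$. A simplicial graph $\Delta$ is $\Gamma$-partite if its vertex set can be partitioned into $n$ non-empty disjoint sets $A_1,\dots,A_n$ (the decomposition of $\Delta$) such that (1) no two vertices of $A_i$ are adjacent; (2) for all $1\le i<j\le n$, the subgraph $\Delta_{ij}$ of $\Delta$ induced by $A_i\cup A_j$ is connected if $s_i$ is adjacent to $s_j$ in $\Gamma$, and otherwise is edgeless (has vertices but no edges). All $\Gamma$-partite graphs are taken to be finite, and "infinitely many" is counted up to graph isomorphism. $\Delta$ has cycle connectors if $\Delta_{ij}$ is either edgeless or a (simple) cycle for every $1\le i<j\le n$. $\Delta$ has path connectors if $\Delta_{ij}$ is either edgeless or a simple path for every $1\le i<j\le n$. Cycles here are cycles as subgraphs, not necessarily induced. *)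

theory Defs
  imports "Graph_Theory.Graph_Theory" "HOL-Library.Disjoint_Sets"
begin

text \<open>
  Finite simplicial graphs are modelled by \<^const>\<open>pair_graph\<close>: finite, loop-free, symmetric
  digraphs without parallel arcs, each undirected edge being a pair of opposite arcs.
\<close>

text \<open>
  \<^const>\<open>pre_digraph.cycle\<close> also accepts the closed walk traversing one edge back and forth; in a
  simplicial graph these are exactly its cycles of length below 3.
\<close>
definition simple_cycle :: "('a, 'b) pre_digraph \<Rightarrow> 'b awalk \<Rightarrow> bool" where
  "simple_cycle G p \<longleftrightarrow> pre_digraph.cycle G p \<and> 3 \<le> length p"

definition edges_of_walk :: "('a, 'b) pre_digraph \<Rightarrow> 'b awalk \<Rightarrow> ('a \<times> 'a) set" where
  "edges_of_walk G p = arc_to_ends G ` set p \<union> (arc_to_ends G ` set p)\<inverse>"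

text \<open>The graph as a whole is a simple cycle, respectively a simple path.\<close>

definition is_cycle_graph :: "('a, 'b) pre_digraph \<Rightarrow> bool" where
  "is_cycle_graph G \<longleftrightarrow> (\<exists>p. simple_cycle G p \<and>
     verts G = tail G ` set p \<and> arcs_ends G = edges_of_walk G p)"

definition is_path_graph :: "('a, 'b) pre_digraph \<Rightarrow> bool" where
  "is_path_graph G \<longleftrightarrow> (\<exists>u p v. pre_digraph.apath G u p v \<and>
     verts G = set (pre_digraph.awalk_verts G u p) \<and> arcs_ends G = edges_of_walk G p)"

definition edgeless :: "('a, 'b) pre_digraph \<Rightarrow> bool" where
  "edgeless G \<longleftrightarrow> arcs G = {}"

definition connector ::
    "'b pair_pre_digraph \<Rightarrow> ('a \<Rightarrow> 'b set) \<Rightarrow> 'a \<Rightarrow> 'a \<Rightarrow> ('b, 'b \<times> 'b) pre_digraph" where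
  "connector \<Delta> A s t = with_proj \<Delta> \<restriction> (A s \<union> A t)"

text \<open>
  The parts are indexed by the vertices of \<open>\<Gamma>\<close> themselves rather than by an enumeration
  of them; only the values of \<open>A\<close> on \<open>pverts \<Gamma>\<close> matter.
\<close>
definition partite_decomposition ::
    "'a pair_pre_digraph \<Rightarrow> 'b pair_pre_digraph \<Rightarrow> ('a \<Rightarrow> 'b set) \<Rightarrow> bool" where
  "partite_decomposition \<Gamma> \<Delta> A \<longleftrightarrow>
     (\<Union>s\<in>pverts \<Gamma>. A s) = pverts \<Delta> \<and>
     disjoint_family_on A (pverts \<Gamma>) \<and>
     (\<forall>s\<in>pverts \<Gamma>. A s \<noteq> {}) \<and>
     (\<forall>s\<in>pverts \<Gamma>. \<forall>x\<in>A s. \<forall>y\<in>A s. (x, y) \<notin> parcs \<Delta>) \<and>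
     (\<forall>s\<in>pverts \<Gamma>. \<forall>t\<in>pverts \<Gamma>. s \<noteq> t \<longrightarrow>
        (if (s, t) \<in> parcs \<Gamma> then connected (connector \<Delta> A s t)
         else edgeless (connector \<Delta> A s t)))"

definition partite_graph :: "'a pair_pre_digraph \<Rightarrow> 'b pair_pre_digraph \<Rightarrow> bool" where
  "partite_graph \<Gamma> \<Delta> \<longleftrightarrow> pair_graph \<Delta> \<and> (\<exists>A. partite_decomposition \<Gamma> \<Delta> A)"

definition partite_graph_cycle_connectors ::
    "'a pair_pre_digraph \<Rightarrow> 'b pair_pre_digraph \<Rightarrow> bool" where
  "partite_graph_cycle_connectors \<Gamma> \<Delta> \<longleftrightarrow> pair_graph \<Delta> \<and>
     (\<exists>A. partite_decomposition \<Gamma> \<Delta> A \<and>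
        (\<forall>s\<in>pverts \<Gamma>. \<forall>t\<in>pverts \<Gamma>. s \<noteq> t \<longrightarrow>
           edgeless (connector \<Delta> A s t) \<or> is_cycle_graph (connector \<Delta> A s t)))"

definition partite_graph_path_connectors ::
    "'a pair_pre_digraph \<Rightarrow> 'b pair_pre_digraph \<Rightarrow> bool" where
  "partite_graph_path_connectors \<Gamma> \<Delta> \<longleftrightarrow> pair_graph \<Delta> \<and>
     (\<exists>A. partite_decomposition \<Gamma> \<Delta> A \<and>
        (\<forall>s\<in>pverts \<Gamma>. \<forall>t\<in>pverts \<Gamma>. s \<noteq> t \<longrightarrow>
           edgeless (connector \<Delta> A s t) \<or> is_path_graph (connector \<Delta> A s t)))"

definition has_simple_cycle_of_length :: "nat \<Rightarrow> 'b pair_pre_digraph \<Rightarrow> bool" where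
  "has_simple_cycle_of_length k \<Delta> \<longleftrightarrow>
     (\<exists>p. simple_cycle (with_proj \<Delta>) p \<and> length p = k)"

text \<open>
  \<open>S\<close> meets infinitely many isomorphism classes. With \<open>nat\<close> as the vertex type no class of finite
  graphs is lost.
\<close>
definition infinite_up_to_iso :: "'b pair_pre_digraph set \<Rightarrow> bool" where
  "infinite_up_to_iso S \<longleftrightarrow>
     infinite (S // {(G, H). G \<in> S \<and> H \<in> S \<and> digraph_iso (with_proj G) (with_proj H)})"

end

theory Submission
  imports Defs "HOL-Number_Theory.Cong" "HOL-Computational_Algebra.Primes" "HOL-Library.Nat_Bijection"
begin

text \<open>
  The graphs are cyclic lifts of \<open>\<Gamma>\<close>. Over each vertex \<open>s\<close> of \<open>\<Gamma>\<close> put a fibre \<open>part s\<close> that is a copy of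
  \<open>\<int>/N\<close>, with \<open>N\<close> a large prime, and number the vertices of \<open>\<Gamma>\<close> injectively. An edge
  \<open>s t\<close> of \<open>\<Gamma>\<close>, directed towards its larger endpoint, gets two labels \<open>2e\<close> and \<open>2e + 1\<close> of its
  own, and \<open>(s, a)\<close> is joined to \<open>(t, a + 5\<^sup>2\<^sup>e)\<close> and to \<open>(t, a + 5\<^sup>2\<^sup>e\<^sup>+\<^sup>1)\<close>. Alternating the two kinds of
  edges moves by \<open>d = 5\<^sup>2\<^sup>e\<^sup>+\<^sup>1 - 5\<^sup>2\<^sup>e = 4 \<cdot> 5\<^sup>2\<^sup>e\<close> within \<open>part s\<close>. Since \<open>0 < d < N\<close> and \<open>N\<close> is prime, \<open>d\<close>
  generates \<open>\<int>/N\<close>, so the connector of \<open>s\<close> and \<open>t\<close> is a single cycle through all \<open>2N\<close>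
  vertices of both fibres. Leaving out one edge of each such cycle gives path connectors.

  Around a closed walk the signed shifts \<open>\<plusminus>5\<^sup>l\<close> add up to \<open>0\<close> modulo \<open>N\<close>. With at most four terms and
  \<open>N\<close> large the sum is \<open>0\<close> as an integer. As \<open>0\<close> has only the trivial base-5 expansion with digits
  between \<open>-4\<close> and \<open>4\<close> (\<open>zero_sum_digits\<close>, \<open>signed_powers_cancel\<close>), every term must cancel against an opposite term with the same label.
  If the two terms belong to consecutive edges, the walk turns back along the edge it came by; in
  a closed walk of length 3 or 4 the only other possibility is that they belong to opposite edges of
  a 4-cycle. These traverse the same edge of \<open>\<Gamma>\<close> in opposite directions, so that the edge between
  them would have both its ends in one fibre. Hence there are no 3-cycles and no 4-cycles
  (\<open>voltage_no_triangle\<close>, \<open>voltage_no_square\<close>).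

  The number of vertices is at least \<open>N\<close>, hence unbounded, and isomorphic graphs have equally many
  vertices; this gives infinitely many isomorphism classes (\<open>infinite_up_to_isoI\<close>).
\<close>

section \<open>Counting isomorphism classes\<close>

text \<open>
  Isomorphic graphs have the same order, so finitely many classes would mean finitely many orders.
\<close>
lemma infinite_up_to_isoI:
  fixes S :: "'b pair_pre_digraph set"
  assumes graph: "\<And>G. G \<in> S \<Longrightarrow> pair_graph G"
    and large: "\<And>n. \<exists>G\<in>S. n \<le> card (pverts G)"
  shows "infinite_up_to_iso S"
  unfolding infinite_up_to_iso_def
proof
  let ?R = "{(G, H). G \<in> S \<and> H \<in> S \<and> digraph_iso (with_proj G) (with_proj H)}"
  let ?order = "\<lambda>G. card (pverts G)"
  assume fin: "finite (S // ?R)"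
  have order_iso: "?order H = ?order G" if "(G, H) \<in> ?R" for G H
  proof -
    from that obtain h where h: "pre_digraph.digraph_isomorphism (with_proj G) h"
      "with_proj H = app_iso h (with_proj G)"
      by (auto simp: digraph_iso_def)
    have "pverts H = iso_verts h ` pverts G"
      using arg_cong[OF h(2), of verts] by simp
    moreover have "inj_on (iso_verts h) (pverts G)"
      using h(1) by (simp add: pre_digraph.digraph_isomorphism_def)
    ultimately show ?thesis by (simp add: card_image)
  qed
  \<comment> \<open>Reflexivity ensures that every member of \<open>S\<close> lies in its own class, so that the classes cover \<open>S\<close>.\<close>
  have refl: "(G, G) \<in> ?R" if "G \<in> S" for G
  proof -
    interpret pair_graph G using graph[OF that] .
    have "digraph_iso (with_proj G) (with_proj G)"
      unfolding digraph_iso_def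
      by (rule exI[of _ "\<lparr>iso_verts = id, iso_arcs = id, iso_head = snd, iso_tail = fst\<rparr>"])
        (auto simp: pre_digraph.digraph_isomorphism_def app_iso_def with_proj_def wf_digraph_axioms[unfolded with_proj_def])
    with that show ?thesis by simp
  qed
  have "finite (?order ` X)" if "X \<in> S // ?R" for X
  proof -
    from that obtain G where "X = ?R `` {G}" by (auto elim: quotientE)
    then have "?order ` X \<subseteq> {?order G}" using order_iso by auto
    then show ?thesis by (rule finite_subset) simp
  qed
  then have "finite (\<Union>X\<in>S // ?R. ?order ` X)" using fin by blast
  moreover have "?order ` S \<subseteq> (\<Union>X\<in>S // ?R. ?order ` X)"
  proof
    fix n assume "n \<in> ?order ` S"
    then obtain G where "G \<in> S" "n = ?order G" by blast
    then show "n \<in> (\<Union>X\<in>S // ?R. ?order ` X)"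
      using refl quotientI[of G S ?R] by blast
  qed
  ultimately have "finite (?order ` S)" by (rule rev_finite_subset)
  then obtain b where "\<forall>n\<in>?order ` S. n \<le> b" by (metis finite_nat_set_iff_bounded_le)
  with large[of "Suc b"] show False by fastforce
qed

section \<open>Graphs traced by a sequence of vertices\<close>

text \<open>
  One orientation only: the graphs below use the union with the converse.
\<close>
definition trace :: "(nat \<Rightarrow> 'b) \<Rightarrow> nat \<Rightarrow> 'b rel" where
  "trace w M = (\<lambda>m. (w m, w (Suc m))) ` {..<M}"

text \<open>
  Stated for an arbitrary starting index, because the recursions consume the walk from its front.
\<close>
lemma pawalk_sequence:
  "pcas (w k) (map (\<lambda>m. (w m, w (Suc m))) [k..<k + M]) (w (k + M))"
  "pawalk_verts (w k) (map (\<lambda>m. (w m, w (Suc m))) [k..<k + M]) = map w [k..<Suc (k + M)]"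
proof (induction M arbitrary: k)
  case (Suc M)
  {
    case 1 show ?case using Suc(1)[of "Suc k"] by (simp add: upt_conv_Cons del: upt_Suc)
  next
    case 2 show ?case using Suc(2)[of "Suc k"] by (simp add: upt_conv_Cons del: upt_Suc)
  }
qed simp_all

lemma set_sequence_arcs: "set (map (\<lambda>m. (w m, w (Suc m))) [0..<M]) = trace w M"
  by (auto simp: trace_def)

lemma edges_of_walk_with_proj:
  "edges_of_walk (with_proj G) p = set p \<union> (set p)\<inverse>"
  by (simp add: edges_of_walk_def arc_to_ends_def)

lemma is_path_graph_sequence:
  assumes "inj_on w {..M}"
  shows "is_path_graph (with_proj \<lparr>pverts = w ` {..M}, parcs = trace w M \<union> (trace w M)\<inverse>\<rparr>)"
proof -
  let ?G = "\<lparr>pverts = w ` {..M}, parcs = trace w M \<union> (trace w M)\<inverse>\<rparr>"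
  let ?p = "map (\<lambda>m. (w m, w (Suc m))) [0..<M]"
  have verts: "pawalk_verts (w 0) ?p = map w [0..<Suc M]"
    using pawalk_sequence(2)[of w 0 M] by simp
  have range: "{0..<Suc M} = {..M}" by auto
  have "pcas (w 0) ?p (w M)" using pawalk_sequence(1)[of w 0 M] by simp
  moreover have "distinct (map w [0..<Suc M])"
    using assms by (simp only: distinct_map set_upt distinct_upt range simp_thms)
  ultimately have "pre_digraph.apath (with_proj ?G) (w 0) ?p (w M)"
    by (simp add: pre_digraph.apath_def pre_digraph.awalk_def cas_with_proj_eq
      awalk_verts_with_proj_eq verts set_sequence_arcs del: set_map upt_Suc)
  moreover have "set (pawalk_verts (w 0) ?p) = w ` {..M}"
    by (simp only: verts set_map set_upt range)
  ultimately show ?thesis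
    unfolding is_path_graph_def edges_of_walk_with_proj
    by (intro exI[of _ "w 0"] exI[of _ ?p] exI[of _ "w M"])
      (simp add: awalk_verts_with_proj_eq set_sequence_arcs del: set_map upt_Suc)
qed

lemma is_cycle_graph_sequence:
  assumes "inj_on w {..<M}" "w M = w 0" "3 \<le> M"
  shows "is_cycle_graph (with_proj \<lparr>pverts = w ` {..<M}, parcs = trace w M \<union> (trace w M)\<inverse>\<rparr>)"
proof -
  let ?G = "\<lparr>pverts = w ` {..<M}, parcs = trace w M \<union> (trace w M)\<inverse>\<rparr>"
  let ?p = "map (\<lambda>m. (w m, w (Suc m))) [0..<M]"
  have verts: "pawalk_verts (w 0) ?p = map w [0..<Suc M]"
    using pawalk_sequence(2)[of w 0 M] by simp
  have "pcas (w 0) ?p (w 0)" using pawalk_sequence(1)[of w 0 M] assms(2) by simp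
  moreover have "distinct (tl (map w [0..<Suc M]))"
  proof -
    \<comment> \<open>Dropping the initial vertex leaves its second occurrence, at index \<open>M\<close>.\<close>
    have "tl (map w [0..<Suc M]) = map w [1..<M] @ [w 0]"
      using assms(2,3) by (simp add: map_tl[symmetric] upt_conv_Cons)
    moreover have "inj_on w {1..<M}" using assms(1) by (rule inj_on_subset) auto
    moreover have "w 0 \<notin> w ` {1..<M}"
      using assms(1,3) by (auto dest: inj_onD)
    ultimately show ?thesis by (simp add: distinct_map)
  qed
  moreover have "w 0 \<in> w ` {..<M}" "?p \<noteq> []" using assms(3) by auto
  ultimately have "simple_cycle (with_proj ?G) ?p"
    using assms(3) unfolding simple_cycle_def pre_digraph.cycle_def
    by (auto simp add: pre_digraph.awalk_def cas_with_proj_eq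
      awalk_verts_with_proj_eq verts set_sequence_arcs simp del: set_map upt_Suc intro!: exI[of _ "w 0"])
  then show ?thesis
    unfolding is_cycle_graph_def edges_of_walk_with_proj
    by (intro exI[of _ ?p])
      (simp add: set_sequence_arcs image_image atLeast0LessThan trace_def del: upt_Suc)
qed

lemma connected_sequence:
  "connected (with_proj \<lparr>pverts = w ` {..M}, parcs = trace w M \<union> (trace w M)\<inverse>\<rparr>)"
proof -
  let ?V = "w ` {..M}" and ?E = "(trace w M \<union> (trace w M)\<inverse>)\<^sup>s"
  have reach: "(w 0, w k) \<in> rtrancl_on ?V ?E" if "k \<le> M" for k
    using that
  proof (induction k)
    case (Suc k)
    have "(w k, w (Suc k)) \<in> ?E" using Suc.prems by (auto simp: trace_def symcl_def)
    then show ?case using Suc by (auto intro: rtrancl_on_into_rtrancl_on)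
  qed auto
  have "sym ?E" by (auto simp: symcl_def intro: symI)
  then have "sym (rtrancl_on ?V ?E)" by (rule rtrancl_on_sym)
  then have "(u, v) \<in> rtrancl_on ?V ?E" if "u \<in> ?V" "v \<in> ?V" for u v
    using that reach by (auto intro: rtrancl_on_trans dest: symD)
  then show ?thesis by (auto simp: connected_conv)
qed

section \<open>Extracting the vertices of short cycles\<close>

lemma three_cycleE:
  assumes "has_simple_cycle_of_length 3 G"
  obtains a b c where "(a, b) \<in> parcs G" "(b, c) \<in> parcs G" "(c, a) \<in> parcs G"
proof -
  from assms obtain p u where p: "length p = 3" "pre_digraph.awalk (with_proj G) u p u"
    by (auto simp: has_simple_cycle_of_length_def simple_cycle_def pre_digraph.cycle_def)
  then obtain e1 e2 e3 where "p = [e1, e2, e3]" by (auto simp: numeral_3_eq_3 length_Suc_conv)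
  with p(2) show ?thesis
    using that[of u "fst e2" "fst e3"]
    by (cases e1; cases e2; cases e3) (auto simp: pre_digraph.awalk_def cas_with_proj_eq)
qed

text \<open>
  Opposite vertices have to be kept apart: walking back and forth along a path with one or two edges
  also gives a closed walk of length 4. In a loop-free graph a closed walk of length 3 has no
  such degenerate form.
\<close>
lemma four_cycleE:
  assumes "has_simple_cycle_of_length 4 G"
  obtains a b c d where "(a, b) \<in> parcs G" "(b, c) \<in> parcs G" "(c, d) \<in> parcs G" "(d, a) \<in> parcs G"
    "a \<noteq> c" "b \<noteq> d"
proof -
  from assms obtain p u where p: "length p = 4" "pre_digraph.awalk (with_proj G) u p u"
    "distinct (tl (pawalk_verts u p))"
    by (auto simp: has_simple_cycle_of_length_def simple_cycle_def pre_digraph.cycle_def awalk_verts_with_proj_eq)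
  then obtain e1 e2 e3 e4 where "p = [e1, e2, e3, e4]"
    by (auto simp: numeral_eq_Suc length_Suc_conv)
  with p(2,3) show ?thesis
    using that[of u "fst e2" "fst e3" "fst e4"]
    by (cases e1; cases e2; cases e3; cases e4) (auto simp: pre_digraph.awalk_def cas_with_proj_eq)
qed

section \<open>Cancellation in sums of signed powers\<close>

text \<open>
  The lowest digit is divisible by \<open>B\<close> and smaller than \<open>B\<close> in absolute value, so it vanishes, and
  the rest can be divided by \<open>B\<close>. Nonzero integers do not have unique expansions with such signed
  digits: \<open>1 = 1 \<cdot> B - (B - 1)\<close>.
\<close>
lemma zero_sum_digits:
  fixes c :: "nat \<Rightarrow> int" and B :: int
  assumes "\<And>k. \<bar>c k\<bar> < B" "(\<Sum>k<K. c k * B ^ k) = 0" "k < K"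
  shows "c k = 0"
  using assms
proof (induction K arbitrary: c k)
  case (Suc K)
  let ?r = "\<Sum>k<K. c (Suc k) * B ^ k"
  have "0 < B" using Suc.prems(1)[of 0] by linarith
  have split: "c 0 + B * ?r = 0"
    using Suc.prems(2) by (simp add: sum.lessThan_Suc_shift sum_distrib_left mult_ac del: sum.lessThan_Suc)
  then have "B dvd c 0" by (metis dvd_add_right_iff dvd_0_right dvd_triv_left add.commute)
  then have "c 0 = 0" using Suc.prems(1)[of 0] by (metis dvd_imp_le_int not_le abs_of_pos \<open>0 < B\<close>)
  moreover have "?r = 0" using split \<open>c 0 = 0\<close> \<open>0 < B\<close> by simp
  ultimately show ?case
    using Suc.IH[of "\<lambda>k. c (Suc k)" "k - 1"] Suc.prems(1,3) by (cases k) auto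
qed simp

text \<open>
  Collecting the terms with exponent \<open>k\<close> gives an expansion of \<open>0\<close> whose digits are bounded by
  the number of terms, so each digit is \<open>0\<close>. If all terms with exponent \<open>l\<close> had the same sign, the digit
  at \<open>l\<close> would be their number up to sign.
\<close>
lemma signed_powers_cancel:
  fixes xs :: "(int \<times> nat) list" and B :: int
  assumes zero: "(\<Sum>(\<sigma>, l)\<leftarrow>xs. \<sigma> * B ^ l) = 0"
    and unit: "\<And>\<sigma> l. (\<sigma>, l) \<in> set xs \<Longrightarrow> \<bar>\<sigma>\<bar> = 1"
    and long: "int (length xs) < B"
    and mem: "(\<sigma>, l) \<in> set xs"
  shows "(- \<sigma>, l) \<in> set xs"
proof (rule ccontr)
  assume no: "(- \<sigma>, l) \<notin> set xs"
  define c where "c ys k = (\<Sum>(\<tau>, m)\<leftarrow>ys. if m = k then \<tau> else 0)"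
    for ys :: "(int \<times> nat) list" and k
  define K where "K = Suc (Max (snd ` set xs))"
  have lab: "snd x < K" if "x \<in> set xs" for x
    using that by (simp add: K_def less_Suc_eq_le)
  have bound: "\<bar>c ys k\<bar> \<le> int (length ys)" if "set ys \<subseteq> set xs" for ys k
    using that
  proof (induction ys)
    case (Cons x ys)
    obtain \<tau> m where x: "x = (\<tau>, m)" by fastforce
    have "\<bar>\<tau>\<bar> = 1" using Cons.prems unit[of \<tau> m] x by simp
    moreover have "\<bar>c ys k\<bar> \<le> int (length ys)" using Cons by simp
    moreover have "c (x # ys) k = (if m = k then \<tau> else 0) + c ys k" by (simp add: c_def x)
    ultimately show ?case using abs_triangle_ineq[of \<tau> "c ys k"] by (cases "m = k") simp_all
  qed (simp add: c_def)
  have regroup: "(\<Sum>k<K. c ys k * B ^ k) = (\<Sum>(\<tau>, m)\<leftarrow>ys. \<tau> * B ^ m)" if "set ys \<subseteq> set xs" for ys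
    using that
  proof (induction ys)
    case (Cons x ys)
    obtain \<tau> m where x: "x = (\<tau>, m)" by fastforce
    have "m < K" using lab[of x] Cons.prems x by simp
    have "(\<Sum>k<K. c (x # ys) k * B ^ k)
        = (\<Sum>k<K. if m = k then \<tau> * B ^ k else 0) + (\<Sum>k<K. c ys k * B ^ k)"
      unfolding sum.distrib[symmetric] by (intro sum.cong) (auto simp: c_def x algebra_simps)
    also have "(\<Sum>k<K. if m = k then \<tau> * B ^ k else 0) = \<tau> * B ^ m"
      using \<open>m < K\<close> by simp
    finally show ?case using Cons x by simp
  qed (simp add: c_def)
  \<comment> \<open>Without an opposite term, all terms with exponent \<open>l\<close> equal \<open>(\<sigma>, l)\<close> and \<open>\<sigma> * c xs l\<close> counts them.\<close>
  have "c xs l = 0"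
  proof (rule zero_sum_digits)
    show "\<bar>c xs k\<bar> < B" for k using bound[of xs k] long by simp
    show "(\<Sum>k<K. c xs k * B ^ k) = 0" using regroup[of xs] zero by simp
    show "l < K" using lab[OF mem] by simp
  qed
  moreover have "\<sigma> * c ys l = int (length (filter ((=) (\<sigma>, l)) ys))" if "set ys \<subseteq> set xs" for ys
    using that
  proof (induction ys)
    case (Cons x ys)
    obtain \<tau> m where x: "x = (\<tau>, m)" by fastforce
    have "\<bar>\<tau>\<bar> = 1" "\<bar>\<sigma>\<bar> = 1" "m = l \<Longrightarrow> \<tau> \<noteq> - \<sigma>"
      using Cons.prems unit[of \<tau> m] unit[OF mem] mem no x by auto
    then have same: "m = l \<Longrightarrow> \<tau> = \<sigma>" and sq: "\<sigma> * \<sigma> = 1"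
      by (auto simp: abs_if split: if_splits)
    have "\<sigma> * c (x # ys) l = (if m = l then \<sigma> * \<tau> else 0) + \<sigma> * c ys l"
      by (simp add: c_def x distrib_left)
    also have "(if m = l then \<sigma> * \<tau> else 0) = (if (\<sigma>, l) = x then 1 else 0)"
    proof (cases "m = l")
      case True
      with same have "\<tau> = \<sigma>" by simp
      with True sq show ?thesis by (simp add: x)
    qed (simp add: x)
    finally show ?case using Cons by simp
  qed (simp add: c_def)
  ultimately have "length (filter ((=) (\<sigma>, l)) xs) = 0" by (metis mult_zero_right of_nat_eq_0_iff subset_refl)
  with mem show False by (auto simp: filter_empty_conv)
qed

section \<open>Voltages around short closed walks\<close>

text \<open>
  An edge of a lift, traversed from \<open>u\<close> to \<open>v\<close>. A vertex is coded as a pair of its fibre and its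
  residue modulo \<open>N\<close>. The quotient \<open>l div 2\<close> codes the underlying edge without its orientation, and the
  parity of \<open>l\<close> tells its two shifts apart; the sign \<open>\<sigma>\<close> records the orientation. The bound
  on \<open>5 ^ l\<close> keeps sums of up to four shifts below \<open>N\<close> in absolute value, and 5 is the least base
  that exceeds the number of these shifts.
\<close>
definition voltage_step :: "nat \<Rightarrow> nat \<Rightarrow> nat \<Rightarrow> int \<Rightarrow> nat \<Rightarrow> bool" where
  "voltage_step N u v \<sigma> l \<longleftrightarrow> (\<exists>i j a b. u = prod_encode (i, a) \<and> v = prod_encode (j, b) \<and>
     i \<noteq> j \<and> a < N \<and> b < N \<and> \<sigma> = (if i < j then 1 else - 1) \<and>
     l div 2 = prod_encode (min i j, max i j) \<and> 4 * 5 ^ l < int N \<and>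
     [int b = int a + \<sigma> * 5 ^ l] (mod int N))"

lemma voltage_step_sym: "voltage_step N u v \<sigma> l \<Longrightarrow> voltage_step N v u (- \<sigma>) l"
proof -
  assume "voltage_step N u v \<sigma> l"
  then obtain i j a b where *: "u = prod_encode (i, a)" "v = prod_encode (j, b)"
     "i \<noteq> j" "a < N" "b < N" "\<sigma> = (if i < j then 1 else - 1)"
     "l div 2 = prod_encode (min i j, max i j)" "4 * 5 ^ l < int N"
     "[int b = int a + \<sigma> * 5 ^ l] (mod int N)"
    unfolding voltage_step_def by blast
  have "[int a = int b + - \<sigma> * 5 ^ l] (mod int N)"
    using cong_sym[OF cong_diff[OF *(9) cong_refl[of "\<sigma> * 5 ^ l"]]] by simp
  with * show ?thesis unfolding voltage_step_def
    by (intro exI[of _ j] exI[of _ i] exI[of _ b] exI[of _ a]) (auto simp: min.commute max.commute)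
qed

text \<open>
  Cancelling terms at consecutive edges: the second step undoes the first.
\<close>
lemma voltage_step_backtrack:
  assumes "voltage_step N u v \<sigma> l" "voltage_step N v w (- \<sigma>) l"
  shows "w = u"
proof -
  from assms(1) obtain i j a b where *: "u = prod_encode (i, a)" "v = prod_encode (j, b)"
     "i \<noteq> j" "a < N" "b < N" "\<sigma> = (if i < j then 1 else - 1)"
     "l div 2 = prod_encode (min i j, max i j)"
     "[int b = int a + \<sigma> * 5 ^ l] (mod int N)"
    unfolding voltage_step_def by blast
  from assms(2) obtain i' a' where **: "w = prod_encode (i', a')" "a' < N"
     "j \<noteq> i'" "l div 2 = prod_encode (min j i', max j i')"
     "[int a' = int b + - \<sigma> * 5 ^ l] (mod int N)"
    unfolding voltage_step_def *(2) by auto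
  have "min i j = min j i' \<and> max i j = max j i'" using *(7) **(4) by simp
  then have "i' = i" using *(3) **(3) by linarith
  have "[int a' = int a] (mod int N)"
    using cong_trans[OF **(5) cong_add[OF *(8) cong_refl[of "- \<sigma> * 5 ^ l"]]] by simp
  then have "a' = a" using *(4) **(2) by (metis cong_int_iff cong_less_modulus_unique_nat)
  with \<open>i' = i\<close> * ** show ?thesis by simp
qed

text \<open>
  Cancelling terms at arbitrary edges: the label determines the unordered pair of fibres, and the
  sign the direction in which they are visited.
\<close>
lemma voltage_step_antiparallel:
  assumes "voltage_step N u v \<sigma> l" "voltage_step N u' v' (- \<sigma>) l"
  shows "fst (prod_decode u') = fst (prod_decode v)" "fst (prod_decode v') = fst (prod_decode u)"
proof -
  from assms(1) obtain i j a b where *: "u = prod_encode (i, a)" "v = prod_encode (j, b)"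
     "i \<noteq> j" "\<sigma> = (if i < j then 1 else - 1)" "l div 2 = prod_encode (min i j, max i j)"
    unfolding voltage_step_def by blast
  from assms(2) obtain i' j' a' b' where **: "u' = prod_encode (i', a')" "v' = prod_encode (j', b')"
     "i' \<noteq> j'" "- \<sigma> = (if i' < j' then 1 else - 1)" "l div 2 = prod_encode (min i' j', max i' j')"
    unfolding voltage_step_def by blast
  have mm: "min i j = min i' j'" "max i j = max i' j'" using *(5) **(5) by simp_all
  have "i < j \<longleftrightarrow> \<not> i' < j'" using *(4) **(4) by (auto split: if_splits)
  with mm have "i' = j \<and> j' = i" using *(3) **(3) by linarith
  then show "fst (prod_decode u') = fst (prod_decode v)" "fst (prod_decode v') = fst (prod_decode u)"
    using * ** by simp_all
qed

lemma voltage_step_parts: "voltage_step N u v \<sigma> l \<Longrightarrow> fst (prod_decode u) \<noteq> fst (prod_decode v)"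
  and voltage_step_unit: "voltage_step N u v \<sigma> l \<Longrightarrow> \<bar>\<sigma>\<bar> = 1"
  and voltage_step_bound: "voltage_step N u v \<sigma> l \<Longrightarrow> 4 * \<bar>\<sigma> * 5 ^ l\<bar> < int N"
  and voltage_step_height: "voltage_step N u v \<sigma> l \<Longrightarrow>
    int N dvd int (snd (prod_decode u)) + \<sigma> * 5 ^ l - int (snd (prod_decode v))"
proof -
  assume "voltage_step N u v \<sigma> l"
  then obtain i j a b where *: "u = prod_encode (i, a)" "v = prod_encode (j, b)"
     "i \<noteq> j" "\<sigma> = (if i < j then 1 else - 1)" "4 * 5 ^ l < int N"
     "[int b = int a + \<sigma> * 5 ^ l] (mod int N)"
    unfolding voltage_step_def by blast
  show "fst (prod_decode u) \<noteq> fst (prod_decode v)" "\<bar>\<sigma>\<bar> = 1" using * by auto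
  show "4 * \<bar>\<sigma> * 5 ^ l\<bar> < int N" using *(4,5) by (simp add: abs_mult)
  show "int N dvd int (snd (prod_decode u)) + \<sigma> * 5 ^ l - int (snd (prod_decode v))"
    using cong_sym[OF *(6)] * by (simp add: cong_iff_dvd_diff)
qed

text \<open>
  The first shift must cancel against one of the others. Against a neighbour in the cyclic order
  (the second or the fourth) this is backtracking. Against the third, the second edge would
  start and end in the same fibre.
\<close>
lemma voltage_no_square:
  assumes s: "voltage_step N u1 u2 \<sigma>1 l1" "voltage_step N u2 u3 \<sigma>2 l2"
    "voltage_step N u3 u4 \<sigma>3 l3" "voltage_step N u4 u1 \<sigma>4 l4"
  shows "u3 = u1 \<or> u4 = u2"
proof -
  let ?xs = "[(\<sigma>1, l1), (\<sigma>2, l2), (\<sigma>3, l3), (\<sigma>4, l4)]"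
  let ?v = "\<sigma>1 * 5 ^ l1 + \<sigma>2 * 5 ^ l2 + \<sigma>3 * 5 ^ l3 + \<sigma>4 * 5 ^ l4"
  have "int N dvd ?v"
    using dvd_add[OF dvd_add[OF voltage_step_height[OF s(1)] voltage_step_height[OF s(2)]]
       dvd_add[OF voltage_step_height[OF s(3)] voltage_step_height[OF s(4)]]]
    by (simp add: algebra_simps)
  moreover have "\<bar>?v\<bar> < int N"
    using s[THEN voltage_step_bound] by linarith
  ultimately have "?v = 0" by (metis dvd_imp_le_int not_le abs_of_nat)
  then have "(- \<sigma>1, l1) \<in> set ?xs"
    using s[THEN voltage_step_unit] by (intro signed_powers_cancel[where B = 5]) (auto simp: add.assoc)
  then consider "\<sigma>2 = - \<sigma>1" "l2 = l1" | "\<sigma>3 = - \<sigma>1" "l3 = l1" | "\<sigma>4 = - \<sigma>1" "l4 = l1"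
    using voltage_step_unit[OF s(1)] by auto
  then show ?thesis
  proof cases
    case 1
    then show ?thesis using voltage_step_backtrack[OF s(1)] s(2) by blast
  next
    case 2
    then show ?thesis using voltage_step_antiparallel(1)[OF s(1)] voltage_step_parts[OF s(2)] s(3)
      by metis
  next
    case 3
    then show ?thesis using voltage_step_backtrack[OF s(4)] s(1) by simp
  qed
qed

text \<open>
  Two edges with cancelling shifts lie over the same edge of the base graph in opposite directions, and
  in a triangle they share a vertex; the third edge would then join a fibre to itself.
\<close>
lemma voltage_no_triangle:
  assumes s: "voltage_step N u1 u2 \<sigma>1 l1" "voltage_step N u2 u3 \<sigma>2 l2"
    "voltage_step N u3 u1 \<sigma>3 l3"
  shows False
proof -
  let ?xs = "[(\<sigma>1, l1), (\<sigma>2, l2), (\<sigma>3, l3)]"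
  let ?v = "\<sigma>1 * 5 ^ l1 + \<sigma>2 * 5 ^ l2 + \<sigma>3 * 5 ^ l3"
  have "int N dvd ?v"
    using dvd_add[OF dvd_add[OF voltage_step_height[OF s(1)] voltage_step_height[OF s(2)]]
       voltage_step_height[OF s(3)]]
    by (simp add: algebra_simps)
  moreover have "\<bar>?v\<bar> < int N"
    using s[THEN voltage_step_bound] by linarith
  ultimately have "?v = 0" by (metis dvd_imp_le_int not_le abs_of_nat)
  then have "(- \<sigma>1, l1) \<in> set ?xs"
    using s[THEN voltage_step_unit] by (intro signed_powers_cancel[where B = 5]) (auto simp: add.assoc)
  then consider "\<sigma>2 = - \<sigma>1" "l2 = l1" | "\<sigma>3 = - \<sigma>1" "l3 = l1"
    using voltage_step_unit[OF s(1)] by auto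
  then show ?thesis
  proof cases
    case 1
    then show ?thesis using voltage_step_antiparallel(2)[OF s(1)] voltage_step_parts[OF s(3)] s(2)
      by metis
  next
    case 2
    then show ?thesis using voltage_step_antiparallel(1)[OF s(1)] voltage_step_parts[OF s(2)] s(3)
      by metis
  qed
qed

section \<open>The cyclic lift of a graph\<close>

text \<open>
  The bound on \<open>N\<close> is for the larger of the two labels of an edge.
\<close>
locale cyclic_lift =
  fixes \<Gamma> :: "'a pair_pre_digraph" and f :: "'a \<Rightarrow> nat" and N :: nat
  assumes base: "pair_graph \<Gamma>"
    and inj: "inj_on f (pverts \<Gamma>)"
    and prime: "prime N"
    and large: "(s, t) \<in> parcs \<Gamma> \<Longrightarrow> 4 * 5 ^ Suc (2 * prod_encode (f s, f t)) < N"
begin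

definition vertex :: "'a \<Rightarrow> nat \<Rightarrow> nat" where
  "vertex s a = prod_encode (f s, a mod N)"

definition part :: "'a \<Rightarrow> nat set" where
  "part s = vertex s ` {..<N}"

definition shift :: "'a \<Rightarrow> 'a \<Rightarrow> nat" where
  "shift s t = 5 ^ (2 * prod_encode (f s, f t))"

text \<open>
  The sequence around the connector of \<open>s\<close> and \<open>t\<close>. With \<open>x = shift s t\<close>, the step from \<open>s\<close> to \<open>t\<close>
  adds \<open>5 * x\<close> and the step back subtracts \<open>x\<close>, so that two steps add \<open>4 * x\<close> in the fibre of \<open>s\<close>.
\<close>
definition zigzag :: "'a \<Rightarrow> 'a \<Rightarrow> nat \<Rightarrow> nat" where
  "zigzag s t m = (if even m then vertex s (m div 2 * (4 * shift s t))
     else vertex t (m div 2 * (4 * shift s t) + 5 * shift s t))"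

text \<open>
  The parameter \<open>M\<close> is the number of edges kept in each connector: \<open>2 * N\<close> of them form a cycle,
  and \<open>2 * N - 1\<close> a path through the same vertices.
\<close>
definition lift :: "nat \<Rightarrow> nat pair_pre_digraph" where
  "lift M = \<lparr>pverts = (\<Union>s\<in>pverts \<Gamma>. part s),
     parcs = (\<Union>(s, t)\<in>{(s, t) \<in> parcs \<Gamma>. f s < f t}. trace (zigzag s t) M \<union> (trace (zigzag s t) M)\<inverse>)\<rparr>"

lemma N_pos: "0 < N"
  using prime by (rule prime_gt_0_nat)

lemma base_arc_verts: "(s, t) \<in> parcs \<Gamma> \<Longrightarrow> s \<in> pverts \<Gamma> \<and> t \<in> pverts \<Gamma>"
proof -
  interpret pair_graph \<Gamma> by (rule base)
  show "(s, t) \<in> parcs \<Gamma> \<Longrightarrow> s \<in> pverts \<Gamma> \<and> t \<in> pverts \<Gamma>" by (blast dest: in_arcsD1 in_arcsD2)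
qed

text \<open>
  The numbering \<open>f\<close> orients every edge of \<open>\<Gamma>\<close>.
\<close>
lemma base_arc_cases:
  assumes "(s, t) \<in> parcs \<Gamma>"
  obtains "f s < f t" | "f t < f s" "(t, s) \<in> parcs \<Gamma>"
proof -
  interpret pair_graph \<Gamma> by (rule base)
  have "s \<noteq> t" using assms no_loops' by blast
  then have "f s \<noteq> f t" using base_arc_verts[OF assms] inj by (auto dest: inj_onD)
  moreover have "(t, s) \<in> parcs \<Gamma>" using assms by (rule arcs_symmetric)
  ultimately show ?thesis using that by (meson linorder_neqE_nat)
qed

lemma vertex_in_part: "vertex s a \<in> part s"
  unfolding part_def by (rule image_eqI[of _ _ "a mod N"]) (use N_pos in \<open>auto simp: vertex_def\<close>)

lemma part_decode: "u \<in> part s \<Longrightarrow> fst (prod_decode u) = f s"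
  by (auto simp: part_def vertex_def)

lemma part_unique:
  assumes "u \<in> part s" "u \<in> part t" "s \<in> pverts \<Gamma>" "t \<in> pverts \<Gamma>"
  shows "s = t"
  using assms part_decode inj by (metis inj_onD)

lemma card_part: "card (part s) = N"
proof -
  have "inj_on (vertex s) {..<N}" by (auto simp: vertex_def intro!: inj_onI)
  then show ?thesis by (simp add: part_def card_image)
qed

lemma finite_part: "finite (part s)"
  by (simp add: part_def)

lemma zigzag_in_parts:
  "even m \<Longrightarrow> zigzag s t m \<in> part s" "odd m \<Longrightarrow> zigzag s t m \<in> part t"
  by (auto simp: zigzag_def vertex_in_part)

lemma trace_zigzag_parts:
  assumes "(u, v) \<in> trace (zigzag s t) M \<union> (trace (zigzag s t) M)\<inverse>"
  shows "u \<in> part s \<and> v \<in> part t \<or> u \<in> part t \<and> v \<in> part s"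
proof -
  from assms obtain m where "(u, v) = (zigzag s t m, zigzag s t (Suc m)) \<or> (v, u) = (zigzag s t m, zigzag s t (Suc m))"
    by (auto simp: trace_def)
  then show ?thesis
    using zigzag_in_parts(1)[of m s t] zigzag_in_parts(2)[of m s t]
      zigzag_in_parts(1)[of "Suc m" s t] zigzag_in_parts(2)[of "Suc m" s t]
    by (cases "even m") auto
qed

text \<open>
  Steps from \<open>s\<close> to \<open>t\<close> carry the odd label of the edge; steps back traverse backwards an edge
  that carries the even label.
\<close>
lemma zigzag_voltage_step:
  assumes "(s, t) \<in> parcs \<Gamma>" "f s < f t"
  shows "\<exists>\<sigma> l. voltage_step N (zigzag s t m) (zigzag s t (Suc m)) \<sigma> l"
proof -
  define e where "e = prod_encode (f s, f t)"
  define k where "k = m div 2"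
  define x where "x = shift s t"
  have x: "x = 5 ^ (2 * e)" by (simp add: x_def shift_def e_def)
  have "4 * 5 ^ Suc (2 * e) < N" using large[OF assms(1)] by (simp add: e_def)
  then have "int (4 * 5 ^ Suc (2 * e)) < int N" by (simp only: of_nat_less_iff)
  then have big: "4 * 5 ^ Suc (2 * e) < int N" "4 * 5 ^ (2 * e) < int N" by simp_all
  have edge: "voltage_step N (vertex s a) (vertex t b) 1 l"
    if "[int b = int a + 5 ^ l] (mod int N)" "l div 2 = e" "4 * 5 ^ l < int N" for a b l
    unfolding voltage_step_def vertex_def
    using that assms(2) N_pos
    by (intro exI[of _ "f s"] exI[of _ "f t"] exI[of _ "a mod N"] exI[of _ "b mod N"])
      (auto simp: e_def cong_def zmod_int mod_add_left_eq)
  show ?thesis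
  proof (cases "even m")
    case True
    have "voltage_step N (vertex s (k * (4 * x))) (vertex t (k * (4 * x) + 5 * x)) 1 (Suc (2 * e))"
      using big by (intro edge) (simp_all add: x)
    then show ?thesis using True by (auto simp: zigzag_def k_def x_def)
  next
    case False
    have "voltage_step N (vertex s (Suc k * (4 * x))) (vertex t (k * (4 * x) + 5 * x)) 1 (2 * e)"
      using big by (intro edge) (simp_all add: x add.commute)
    then have "voltage_step N (vertex t (k * (4 * x) + 5 * x)) (vertex s (Suc k * (4 * x))) (- 1) (2 * e)"
      by (rule voltage_step_sym)
    moreover have "Suc m div 2 = Suc k" using False by (simp add: k_def)
    then have "zigzag s t m = vertex t (k * (4 * x) + 5 * x)"
      "zigzag s t (Suc m) = vertex s (Suc k * (4 * x))"
      using False by (simp_all only: zigzag_def k_def x_def even_Suc if_True if_False not_not simp_thms)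
    ultimately show ?thesis by metis
  qed
qed

text \<open>
  The shift \<open>4 * shift s t\<close> is positive and less than the prime \<open>N\<close>, so its multiples by
  \<open>0, \<dots>, N - 1\<close> are distinct modulo \<open>N\<close>.
\<close>
lemma zigzag_inj:
  assumes "(s, t) \<in> parcs \<Gamma>" "f s < f t"
  shows "inj_on (zigzag s t) {..<2 * N}"
proof (rule inj_onI)
  fix m n assume mn: "m \<in> {..<2 * N}" "n \<in> {..<2 * N}" and eq: "zigzag s t m = zigzag s t n"
  let ?d = "4 * shift s t"
  have "?d < N" using large[OF assms(1)] by (simp add: shift_def)
  moreover have "0 < ?d" by (simp add: shift_def)
  ultimately have "\<not> N dvd ?d" by (simp add: nat_dvd_not_less)
  then have coprime: "coprime ?d N" using prime prime_imp_coprime coprime_commute by blast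
  have parity: "even m \<longleftrightarrow> even n"
    using eq assms(2) by (auto simp: zigzag_def vertex_def split: if_splits)
  have "[m div 2 * ?d = n div 2 * ?d] (mod N)"
  proof (cases "even m")
    case True
    then show ?thesis using eq parity by (simp add: zigzag_def vertex_def cong_def)
  next
    case False
    then have "[m div 2 * ?d + 5 * shift s t = n div 2 * ?d + 5 * shift s t] (mod N)"
      using eq parity by (simp add: zigzag_def vertex_def cong_def)
    then show ?thesis by (simp only: cong_add_rcancel_nat)
  qed
  then have "[m div 2 = n div 2] (mod N)" using cong_mult_rcancel_nat[OF coprime] by blast
  then have "m div 2 = n div 2" using mn by (intro cong_less_modulus_unique_nat) auto
  then show "m = n" using parity by (metis mult_div_mod_eq parity_cases)
qed

lemma zigzag_closes: "zigzag s t (2 * N) = zigzag s t 0"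
  by (simp add: zigzag_def vertex_def)

text \<open>
  By injectivity the sequence has \<open>2 * N\<close> values, which is the number of vertices in the two fibres.
\<close>
lemma zigzag_range:
  assumes "(s, t) \<in> parcs \<Gamma>" "f s < f t"
  shows "zigzag s t ` {..<2 * N} = part s \<union> part t"
proof (rule card_subset_eq)
  show "finite (part s \<union> part t)" by (simp add: finite_part)
  show "zigzag s t ` {..<2 * N} \<subseteq> part s \<union> part t" using zigzag_in_parts by blast
  have "part s \<inter> part t = {}"
    using part_decode[of _ s] part_decode[of _ t] assms(2) by (metis disjoint_iff less_irrefl)
  then have "card (part s \<union> part t) = 2 * N"
    by (simp add: card_Un_disjoint finite_part card_part)
  then show "card (zigzag s t ` {..<2 * N}) = card (part s \<union> part t)"
    using zigzag_inj[OF assms] by (simp add: card_image)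
qed

lemma pair_graph_lift: "pair_graph (lift M)"
proof
  interpret G: pair_graph \<Gamma> by (rule base)
  have arcE: "\<exists>s t. s \<in> pverts \<Gamma> \<and> t \<in> pverts \<Gamma> \<and> f s < f t \<and>
      (fst e \<in> part s \<and> snd e \<in> part t \<or> fst e \<in> part t \<and> snd e \<in> part s)"
    if e: "e \<in> parcs (lift M)" for e
  proof -
    from e obtain s t where "(s, t) \<in> parcs \<Gamma>" "f s < f t"
      "e \<in> trace (zigzag s t) M \<union> (trace (zigzag s t) M)\<inverse>" by (auto simp: lift_def)
    then show ?thesis
      using trace_zigzag_parts[of "fst e" "snd e"] base_arc_verts by (metis prod.collapse)
  qed
  show "fst e \<in> pverts (lift M)" "snd e \<in> pverts (lift M)" if "e \<in> parcs (lift M)" for e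
    using arcE[OF that] by (auto simp: lift_def)
  show "fst e \<noteq> snd e" if "e \<in> parcs (lift M)" for e
    using arcE[OF that] part_decode by (metis less_irrefl)
  show fin: "finite (pverts (lift M))"
    using G.pair_finite_verts by (simp add: lift_def finite_part)
  have "parcs (lift M) \<subseteq> pverts (lift M) \<times> pverts (lift M)"
    using arcE by (fastforce simp: lift_def)
  with fin show "finite (parcs (lift M))" by (meson finite_SigmaI rev_finite_subset)
  show "symmetric (with_proj (lift M))"
    by (auto simp: symmetric_def lift_def intro!: symI)
qed

lemma lift_no_short_cycles:
  "\<not> has_simple_cycle_of_length 4 (lift M)" "\<not> has_simple_cycle_of_length 3 (lift M)"
proof -
  have step: "\<exists>\<sigma> l. voltage_step N u v \<sigma> l" if uv: "(u, v) \<in> parcs (lift M)" for u v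
  proof -
    from uv obtain s t m where "(s, t) \<in> parcs \<Gamma>" "f s < f t"
      "(u, v) = (zigzag s t m, zigzag s t (Suc m)) \<or> (v, u) = (zigzag s t m, zigzag s t (Suc m))"
      by (auto simp: lift_def trace_def)
    then show ?thesis using zigzag_voltage_step voltage_step_sym by blast
  qed
  show "\<not> has_simple_cycle_of_length 4 (lift M)"
  proof
    assume "has_simple_cycle_of_length 4 (lift M)"
    then obtain a b c d where "(a, b) \<in> parcs (lift M)" "(b, c) \<in> parcs (lift M)"
      "(c, d) \<in> parcs (lift M)" "(d, a) \<in> parcs (lift M)" and "a \<noteq> c" "b \<noteq> d"
      by (rule four_cycleE)
    then show False using step voltage_no_square by metis
  qed
  show "\<not> has_simple_cycle_of_length 3 (lift M)"
  proof
    assume "has_simple_cycle_of_length 3 (lift M)"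
    then obtain a b c where "(a, b) \<in> parcs (lift M)" "(b, c) \<in> parcs (lift M)"
      "(c, a) \<in> parcs (lift M)"
      by (rule three_cycleE)
    then show False using step voltage_no_triangle by metis
  qed
qed

text \<open>
  The fibres determine the edge of \<open>\<Gamma>\<close> over which an edge of the lift lies, so no other
  connector contributes edges between the fibres of \<open>s\<close> and \<open>t\<close>.
\<close>
lemma connector_lift_adjacent:
  assumes st: "(s, t) \<in> parcs \<Gamma>" "f s < f t"
  shows "connector (lift M) part s t = with_proj
    \<lparr>pverts = part s \<union> part t, parcs = trace (zigzag s t) M \<union> (trace (zigzag s t) M)\<inverse>\<rparr>"
proof -
  let ?E = "\<lambda>s t. trace (zigzag s t) M \<union> (trace (zigzag s t) M)\<inverse>"
  have "e \<in> ?E s t" if e: "e \<in> parcs (lift M)" "fst e \<in> part s \<union> part t" "snd e \<in> part s \<union> part t" for e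
  proof -
    from e(1) obtain s' t' where st': "(s', t') \<in> parcs \<Gamma>" "f s' < f t'" "e \<in> ?E s' t'"
      by (auto simp: lift_def)
    from st'(3) have "fst e \<in> part s' \<and> snd e \<in> part t' \<or> fst e \<in> part t' \<and> snd e \<in> part s'"
      using trace_zigzag_parts[of "fst e" "snd e"] by simp
    then have "{fst (prod_decode (fst e)), fst (prod_decode (snd e))} = {f s', f t'}"
      using part_decode by auto
    moreover have "{fst (prod_decode (fst e)), fst (prod_decode (snd e))} \<subseteq> {f s, f t}"
      using e(2,3) part_decode by auto
    ultimately have "{f s', f t'} \<subseteq> {f s, f t}" by simp
    then have "f s' = f s" "f t' = f t" using st(2) st'(2) by auto
    then have "s' = s" "t' = t"
      using inj base_arc_verts[OF st(1)] base_arc_verts[OF st'(1)] by (auto dest: inj_onD)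
    with st'(3) show ?thesis by simp
  qed
  moreover have "e \<in> parcs (lift M) \<and> fst e \<in> part s \<union> part t \<and> snd e \<in> part s \<union> part t"
    if e: "e \<in> ?E s t" for e
    using e st trace_zigzag_parts[of "fst e" "snd e" s t M] by (auto simp: lift_def)
  ultimately have "{e \<in> parcs (lift M). fst e \<in> part s \<union> part t \<and> snd e \<in> part s \<union> part t} = ?E s t"
    by blast
  then show ?thesis by (simp add: connector_def induce_subgraph_def with_proj_def)
qed

text \<open>
  The lift maps to \<open>\<Gamma>\<close>. For \<open>s = t\<close> this says that fibres are independent sets, as \<open>\<Gamma>\<close> has no loops.
\<close>
lemma lift_arc_project:
  assumes "(x, y) \<in> parcs (lift M)" "x \<in> part s" "y \<in> part t" "s \<in> pverts \<Gamma>" "t \<in> pverts \<Gamma>"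
  shows "(s, t) \<in> parcs \<Gamma>"
proof -
  interpret G: pair_graph \<Gamma> by (rule base)
  from assms(1) obtain s' t' where st': "(s', t') \<in> parcs \<Gamma>"
    "(x, y) \<in> trace (zigzag s' t') M \<union> (trace (zigzag s' t') M)\<inverse>"
    by (auto simp: lift_def)
  from trace_zigzag_parts[OF st'(2)] have "s = s' \<and> t = t' \<or> s = t' \<and> t = s'"
    using part_unique assms(2-5) base_arc_verts[OF st'(1)] by metis
  then show ?thesis using st'(1) G.arcs_symmetric by blast
qed

lemma connector_lift_nonadjacent:
  assumes "s \<in> pverts \<Gamma>" "t \<in> pverts \<Gamma>" "(s, t) \<notin> parcs \<Gamma>"
  shows "edgeless (connector (lift M) part s t)"
proof -
  interpret G: pair_graph \<Gamma> by (rule base)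
  have "(t, s) \<notin> parcs \<Gamma>" "(s, s) \<notin> parcs \<Gamma>" "(t, t) \<notin> parcs \<Gamma>"
    using assms(3) G.arcs_symmetric G.no_loops' by blast+
  then have "e \<notin> parcs (lift M)" if "fst e \<in> part s \<union> part t" "snd e \<in> part s \<union> part t" for e
    using that assms lift_arc_project[of "fst e" "snd e"] by auto
  then show ?thesis by (auto simp: edgeless_def connector_def)
qed

lemma connector_commute: "connector \<Delta> A s t = connector \<Delta> A t s"
  by (simp add: connector_def Un_commute)

text \<open>
  A connector does not depend on the order of its two fibres, so it suffices to consider an edge of
  \<open>\<Gamma>\<close> in its chosen direction.
\<close>
lemma connector_lift_cases:
  assumes adjacent: "\<And>s t. \<lbrakk>(s, t) \<in> parcs \<Gamma>; f s < f t\<rbrakk> \<Longrightarrow> P (with_proj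
    \<lparr>pverts = part s \<union> part t, parcs = trace (zigzag s t) M \<union> (trace (zigzag s t) M)\<inverse>\<rparr>)"
    and st: "(s, t) \<in> parcs \<Gamma>"
  shows "P (connector (lift M) part s t)"
  using st
proof (cases rule: base_arc_cases)
  case 1
  then show ?thesis using adjacent st connector_lift_adjacent by simp
next
  case 2
  then show ?thesis using adjacent connector_lift_adjacent connector_commute by metis
qed

text \<open>
  For the path, with \<open>M = 2 * N - 1\<close>, the indices are exactly those of one round; for the cycle, with
  \<open>M = 2 * N\<close>, the last index repeats the initial vertex.
\<close>
lemma zigzag_range_atMost:
  assumes "(s, t) \<in> parcs \<Gamma>" "f s < f t" "2 * N \<le> Suc M"
  shows "part s \<union> part t = zigzag s t ` {..M}"
proof
  have "{..<2 * N} \<subseteq> {..M}" using assms(3) by auto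
  then show "part s \<union> part t \<subseteq> zigzag s t ` {..M}"
    unfolding zigzag_range[OF assms(1,2), symmetric] by (rule image_mono)
  show "zigzag s t ` {..M} \<subseteq> part s \<union> part t" using zigzag_in_parts by blast
qed

lemma partite_decomposition_lift:
  assumes "2 * N \<le> Suc M"
  shows "partite_decomposition \<Gamma> (lift M) part"
proof -
  interpret G: pair_graph \<Gamma> by (rule base)
  have "connected (connector (lift M) part s t)" if "(s, t) \<in> parcs \<Gamma>" for s t
    using that
  proof (rule connector_lift_cases[rotated])
    fix s t assume st: "(s, t) \<in> parcs \<Gamma>" "f s < f t"
    show "connected (with_proj \<lparr>pverts = part s \<union> part t,
        parcs = trace (zigzag s t) M \<union> (trace (zigzag s t) M)\<inverse>\<rparr>)"
      unfolding zigzag_range_atMost[OF st assms] by (rule connected_sequence)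
  qed
  moreover have "disjoint_family_on part (pverts \<Gamma>)"
    using part_unique by (auto simp: disjoint_family_on_def)
  moreover have "(x, y) \<notin> parcs (lift M)" if "s \<in> pverts \<Gamma>" "x \<in> part s" "y \<in> part s" for s x y
    using lift_arc_project[of x y M s s] that G.no_loops' by blast
  moreover have "\<forall>s\<in>pverts \<Gamma>. part s \<noteq> {}" using vertex_in_part by blast
  moreover have "(\<Union>s\<in>pverts \<Gamma>. part s) = pverts (lift M)" by (simp add: lift_def)
  ultimately show ?thesis
    unfolding partite_decomposition_def using connector_lift_nonadjacent by simp
qed

lemma lift_cycle_connectors: "partite_graph_cycle_connectors \<Gamma> (lift (2 * N))"
proof -
  have "is_cycle_graph (connector (lift (2 * N)) part s t)" if "(s, t) \<in> parcs \<Gamma>" for s t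
    using that
  proof (rule connector_lift_cases[rotated])
    fix s t assume st: "(s, t) \<in> parcs \<Gamma>" "f s < f t"
    show "is_cycle_graph (with_proj \<lparr>pverts = part s \<union> part t,
        parcs = trace (zigzag s t) (2 * N) \<union> (trace (zigzag s t) (2 * N))\<inverse>\<rparr>)"
      unfolding zigzag_range[OF st, symmetric]
      using zigzag_inj[OF st] zigzag_closes prime_ge_2_nat[OF prime]
      by (intro is_cycle_graph_sequence) auto
  qed
  then show ?thesis
    unfolding partite_graph_cycle_connectors_def
    using pair_graph_lift partite_decomposition_lift[of "2 * N"] connector_lift_nonadjacent
    by fastforce
qed

lemma lift_path_connectors: "partite_graph_path_connectors \<Gamma> (lift (2 * N - 1))"
proof -
  have upto: "{..2 * N - 1} = {..<2 * N}" using N_pos by auto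
  have "is_path_graph (connector (lift (2 * N - 1)) part s t)" if "(s, t) \<in> parcs \<Gamma>" for s t
    using that
  proof (rule connector_lift_cases[rotated])
    fix s t assume st: "(s, t) \<in> parcs \<Gamma>" "f s < f t"
    show "is_path_graph (with_proj \<lparr>pverts = part s \<union> part t,
        parcs = trace (zigzag s t) (2 * N - 1) \<union> (trace (zigzag s t) (2 * N - 1))\<inverse>\<rparr>)"
      unfolding zigzag_range[OF st, symmetric] upto[symmetric]
      by (rule is_path_graph_sequence) (simp only: upto zigzag_inj[OF st])
  qed
  then show ?thesis
    unfolding partite_graph_path_connectors_def
    using pair_graph_lift partite_decomposition_lift[of "2 * N - 1"] connector_lift_nonadjacent
    by fastforce
qed

lemma lift_order:
  assumes "pverts \<Gamma> \<noteq> {}"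
  shows "N \<le> card (pverts (lift M))"
proof -
  interpret L: pair_graph "lift M" by (rule pair_graph_lift)
  obtain s where "s \<in> pverts \<Gamma>" using assms by blast
  then have "part s \<subseteq> pverts (lift M)" by (auto simp: lift_def)
  then show ?thesis using card_mono[OF L.pair_finite_verts] card_part by metis
qed

end

section \<open>Infinitely many lifts\<close>

lemma ex_cyclic_lift:
  fixes \<Gamma> :: "'a pair_pre_digraph"
  assumes "pair_graph \<Gamma>"
  shows "\<exists>f N. cyclic_lift \<Gamma> f N \<and> n \<le> N"
proof -
  interpret pair_graph \<Gamma> by (rule assms)
  obtain f :: "'a \<Rightarrow> nat" where f: "inj_on f (pverts \<Gamma>)"
    using finite_imp_inj_to_nat_seg[OF pair_finite_verts] by blast
  let ?b = "\<lambda>e. 4 * 5 ^ Suc (2 * prod_encode (f (fst e), f (snd e))) :: nat"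
  \<comment> \<open>The sum is a convenient common upper bound for the finitely many conditions on \<open>N\<close>.\<close>
  obtain N where N: "prime N" "n + sum ?b (parcs \<Gamma>) < N" using bigger_prime by blast
  have "?b e < N" if "e \<in> parcs \<Gamma>" for e
    using member_le_sum[OF that, of ?b] pair_finite_arcs N(2) by simp
  then have "cyclic_lift \<Gamma> f N"
    using assms f N(1) by (intro cyclic_lift.intro) force+
  with N(2) show ?thesis by (intro exI[of _ f] exI[of _ N]) simp
qed

theorem theorem3p1:
  fixes \<Gamma> :: "'a pair_pre_digraph"
  assumes "pair_graph \<Gamma>"
    and "pverts \<Gamma> \<noteq> {}"
  shows
    "infinite_up_to_iso {\<Delta> :: nat pair_pre_digraph. partite_graph \<Gamma> \<Delta> \<and>
        \<not> has_simple_cycle_of_length 4 \<Delta> \<and> \<not> has_simple_cycle_of_length 3 \<Delta>} \<and>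
     infinite_up_to_iso {\<Delta> :: nat pair_pre_digraph. partite_graph_cycle_connectors \<Gamma> \<Delta> \<and>
        \<not> has_simple_cycle_of_length 4 \<Delta> \<and> \<not> has_simple_cycle_of_length 3 \<Delta>} \<and>
     infinite_up_to_iso {\<Delta> :: nat pair_pre_digraph. partite_graph_path_connectors \<Gamma> \<Delta> \<and>
        \<not> has_simple_cycle_of_length 4 \<Delta> \<and> \<not> has_simple_cycle_of_length 3 \<Delta>}"
proof (intro conjI)
  have large_cycle: "\<exists>\<Delta> :: nat pair_pre_digraph. partite_graph_cycle_connectors \<Gamma> \<Delta> \<and>
      \<not> has_simple_cycle_of_length 4 \<Delta> \<and> \<not> has_simple_cycle_of_length 3 \<Delta> \<and>
      n \<le> card (pverts \<Delta>)" for n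
  proof -
    obtain f N where "cyclic_lift \<Gamma> f N" "n \<le> N" using ex_cyclic_lift[OF assms(1)] by blast
    then interpret cyclic_lift \<Gamma> f N by simp
    show ?thesis
      using lift_cycle_connectors lift_no_short_cycles lift_order[OF assms(2)] \<open>n \<le> N\<close> le_trans by blast
  qed
  have large_path: "\<exists>\<Delta> :: nat pair_pre_digraph. partite_graph_path_connectors \<Gamma> \<Delta> \<and>
      \<not> has_simple_cycle_of_length 4 \<Delta> \<and> \<not> has_simple_cycle_of_length 3 \<Delta> \<and>
      n \<le> card (pverts \<Delta>)" for n
  proof -
    obtain f N where "cyclic_lift \<Gamma> f N" "n \<le> N" using ex_cyclic_lift[OF assms(1)] by blast
    then interpret cyclic_lift \<Gamma> f N by simp
    show ?thesis
      using lift_path_connectors lift_no_short_cycles lift_order[OF assms(2)] \<open>n \<le> N\<close> le_trans by blast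
  qed
  have forget: "partite_graph \<Gamma> \<Delta>" if "partite_graph_cycle_connectors \<Gamma> \<Delta>"
    for \<Delta> :: "nat pair_pre_digraph"
    using that by (auto simp: partite_graph_def partite_graph_cycle_connectors_def)
  let ?sparse = "\<lambda>\<Delta> :: nat pair_pre_digraph.
    \<not> has_simple_cycle_of_length 4 \<Delta> \<and> \<not> has_simple_cycle_of_length 3 \<Delta>"
  show "infinite_up_to_iso {\<Delta>. partite_graph \<Gamma> \<Delta> \<and> ?sparse \<Delta>}"
  proof (rule infinite_up_to_isoI)
    show "pair_graph \<Delta>" if "\<Delta> \<in> {\<Delta>. partite_graph \<Gamma> \<Delta> \<and> ?sparse \<Delta>}" for \<Delta>
      using that by (simp add: partite_graph_def)
    show "\<exists>\<Delta>\<in>{\<Delta>. partite_graph \<Gamma> \<Delta> \<and> ?sparse \<Delta>}. n \<le> card (pverts \<Delta>)" for n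
      using large_cycle[of n] forget by blast
  qed
  show "infinite_up_to_iso {\<Delta>. partite_graph_cycle_connectors \<Gamma> \<Delta> \<and> ?sparse \<Delta>}"
  proof (rule infinite_up_to_isoI)
    show "pair_graph \<Delta>" if "\<Delta> \<in> {\<Delta>. partite_graph_cycle_connectors \<Gamma> \<Delta> \<and> ?sparse \<Delta>}" for \<Delta>
      using that by (simp add: partite_graph_cycle_connectors_def)
    show "\<exists>\<Delta>\<in>{\<Delta>. partite_graph_cycle_connectors \<Gamma> \<Delta> \<and> ?sparse \<Delta>}. n \<le> card (pverts \<Delta>)" for n
      using large_cycle[of n] by blast
  qed
  show "infinite_up_to_iso {\<Delta>. partite_graph_path_connectors \<Gamma> \<Delta> \<and> ?sparse \<Delta>}"
  proof (rule infinite_up_to_isoI)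
    show "pair_graph \<Delta>" if "\<Delta> \<in> {\<Delta>. partite_graph_path_connectors \<Gamma> \<Delta> \<and> ?sparse \<Delta>}" for \<Delta>
      using that by (simp add: partite_graph_path_connectors_def)
    show "\<exists>\<Delta>\<in>{\<Delta>. partite_graph_path_connectors \<Gamma> \<Delta> \<and> ?sparse \<Delta>}. n \<le> card (pverts \<Delta>)" for n
      using large_path[of n] by blast
  qed
qed

end
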